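(* Let $\mathcal{RM}(\alpha_1,\ldots,\alpha_n)$ be a bi-rainbow meander, $n\ge1$, and let $m^*$, $L^*$, $R^*$ denote the index of the middle rainbow family and the total numbers of upper arcs in the families to its left and to its right. The number $\mathcal{Z}$ of connected components satisfies the following recursion (the first applicable case is used): $$\mathcal{Z}(\alpha_1,\ldots,\alpha_n)=\begin{cases} \mathcal{Z}(\alpha_1,\ldots,\alpha_{m^*-1},\alpha_{m^*+1},\ldots,\alpha_n)+\alpha_{m^*}, & L^*=R^*,\\ \mathcal{Z}(\alpha_1,\ldots,\alpha_{m^*-1},\alpha_{m^*+1},\ldots,\alpha_n), & |L^*-R^*|\ \text{divides}\ \alpha_{m^*},\\ \mathcal{Z}\bigl(\alpha_1,\ldots,\alpha_{m^*-1},\mathscr{R}(\alpha_{m^*},|L^*-R^*|),\alpha_{m^*+1},\ldots,\alpha_n\bigr), & \text{otherwise.} \end{cases}$$ Iterating this recursion (recomputing $m^*,L^*,R^*$ in every step) gives an algorithm that determines the number $\mathcal{Z}(\alpha_1,\ldots,\alpha_n)$ with logarithmic complexity $\mathcal{O}(b)\,\mathcal{O}(n)$, where $b=\sum_{\ell=1}^n\lceil\log_2(\alpha_\ell+1)\rceil$ is the number of bits needed to encode the input $(\alpha_1,\ldots,\alpha_n)$.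
   Context: For positive integers $\alpha_1,\ldots,\alpha_n$ put $\alpha=\sum_{\ell=1}^n\alpha_\ell$. The bi-rainbow meander $\mathcal{RM}(\alpha_1,\ldots,\alpha_n)$ is the planar configuration of arcs with endpoints at the points $1,2,\ldots,2\alpha$ of the horizontal axis, defined as follows. Above the axis there are $n$ rainbow families of nested arcs: with $s_\ell=2\sum_{k<\ell}\alpha_k$, the $\ell$-th family consists of the $\alpha_\ell$ arcs joining $s_\ell+i$ with $s_\ell+2\alpha_\ell+1-i$, $i=1,\ldots,\alpha_\ell$. Below the axis there is one rainbow family of $\alpha$ nested arcs, joining $k$ with $2\alpha+1-k$, $k=1,\ldots,\alpha$. The union of all upper and lower arcs is a disjoint union of closed Jordan curves; $\mathcal{Z}(\alpha_1,\ldots,\alpha_n)$ denotes the number of these curves (connected components). Equivalently, it is the number of orbits on $\{1,\ldots,2\alpha\}$ of the group generated by the two involutions given by the upper and by the lower arcs. $\mathcal{Z}$ of the empty tuple is $0$. Middle rainbow family: let $L(\ell)=\alpha_1+\cdots+\alpha_{\ell-1}$ for $1\le\ell\le n+1$ and $R(\ell)=\alpha_{\ell+1}+\cdots+\alpha_n$ for $1\le\ell\le n$. Then $m^*\in\{1,\ldots,n\}$ is the unique index with $L(m^* )<\alpha/2\le L(m^*+1)$, and $L^*=L(m^* )$, $R^*=R(m^* )$. $\mathscr{R}(a,c)$ denotes the remainder of the integer division $a/c$, $0\le\mathscr{R}(a,c)<c$. Complexity is measured by counting elementary integer operations (comparison, addition, subtraction, division with remainder), each assumed to cost $\mathcal{O}(1)$;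 the cost of arithmetic with large integers is not considered. *)

theory Defs
  imports "HOL-Analysis.Analysis" "HOL-Library.State_Monad" "HOL-Library.While_Combinator"
begin

text \<open>
  A tuple of family sizes is a \<open>nat list\<close>, indexed from 0: the entry \<open>as ! m\<close> is the size
  \<open>\<alpha>\<close> of family number \<open>m + 1\<close>. Statements about meanders assume all entries to be positive.
\<close>


subsection \<open>Bi-rainbow meanders and their connected components\<close>

text \<open>
  The arcs are drawn as half circles; the endpoints \<open>1, \<dots>, 2\<alpha>\<close> lie on the real axis of the
  complex plane. Within a rainbow, half circles are concentric, and different upper families stand
  side by side, so arcs on the same side of the axis never meet.
\<close>

definition upper_arc :: "nat \<Rightarrow> nat \<Rightarrow> complex set" where
  "upper_arc p q =
     {z. 0 \<le> Im z \<and> dist z (complex_of_real ((real p + real q) / 2)) = (real q - real p) / 2}"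

definition lower_arc :: "nat \<Rightarrow> nat \<Rightarrow> complex set" where
  "lower_arc p q =
     {z. Im z \<le> 0 \<and> dist z (complex_of_real ((real p + real q) / 2)) = (real q - real p) / 2}"

definition meander :: "nat list \<Rightarrow> complex set" where
  "meander as =
     (\<Union>m<length as. \<Union>i\<in>{1..as ! m}.
        let s = 2 * sum_list (take m as) in upper_arc (s + i) (s + 2 * (as ! m) + 1 - i)) \<union>
     (\<Union>k\<in>{1..sum_list as}. lower_arc k (2 * sum_list as + 1 - k))"

text \<open>The meander is a disjoint union of closed Jordan curves, which are its connected components.\<close>

definition num_components :: "nat list \<Rightarrow> nat" where
  "num_components as = card (components (meander as))"


subsection \<open>The middle rainbow family\<close>

definition arcs_left :: "nat list \<Rightarrow> nat \<Rightarrow> nat" where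
  "arcs_left as m = sum_list (take m as)"

definition arcs_right :: "nat list \<Rightarrow> nat \<Rightarrow> nat" where
  "arcs_right as m = sum_list (drop (Suc m) as)"

definition is_middle :: "nat list \<Rightarrow> nat \<Rightarrow> bool" where
  "is_middle as m \<longleftrightarrow> m < length as \<and>
     real (arcs_left as m) < real (sum_list as) / 2 \<and>
     real (sum_list as) / 2 \<le> real (arcs_left as (Suc m))"

definition middle :: "nat list \<Rightarrow> nat" where
  "middle as = (THE m. is_middle as m)"

lemma ex1_is_middle:
  assumes "as \<noteq> []" and "\<forall>a\<in>set as. 0 < a"
  shows "\<exists>!m. is_middle as m"
proof -
  let ?S = "sum_list as"
  let ?P = "\<lambda>m. ?S \<le> 2 * arcs_left as (Suc m)"
  have pos: "0 < ?S"
    using assms by (cases as) auto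
  have mono: "arcs_left as i \<le> arcs_left as j" if "i \<le> j" for i j
  proof -
    have "take j as = take i as @ take (j - i) (drop i as)"
      using that by (metis le_add_diff_inverse take_add)
    then show ?thesis by (simp add: arcs_left_def)
  qed
  have iff: "is_middle as m \<longleftrightarrow> m < length as \<and> 2 * arcs_left as m < ?S \<and> ?P m" for m
    unfolding is_middle_def by linarith
  define m where "m = (LEAST m. ?P m)"
  have last: "?P (length as - 1)"
    using assms by (simp add: arcs_left_def)
  have Pm: "?P m"
    unfolding m_def by (rule LeastI[of ?P, OF last])
  have "m \<le> length as - 1"
    unfolding m_def by (rule Least_le[of ?P, OF last])
  then have "m < length as"
    using assms by (cases as) auto
  moreover have "2 * arcs_left as m < ?S"
  proof (cases m)
    case 0
    then show ?thesis using pos by (simp add: arcs_left_def)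
  next
    case (Suc k)
    then have "\<not> ?P k"
      unfolding m_def by (intro not_less_Least) simp
    then show ?thesis using Suc by simp
  qed
  ultimately have "is_middle as m"
    using Pm iff by blast
  moreover have "m' = m''" if "is_middle as m'" "is_middle as m''" for m' m''
    using that mono[of "Suc m'" m''] mono[of "Suc m''" m'] unfolding iff
    by (metis Suc_leI leD le_trans linorder_neqE_nat mult_le_mono2)
  ultimately show ?thesis by blast
qed

definition delete_nth :: "nat \<Rightarrow> 'a list \<Rightarrow> 'a list" where
  "delete_nth m xs = take m xs @ drop (Suc m) xs"


subsection \<open>The algorithm, with counted integer operations\<close>

text \<open>
  The state of the monad is the number of elementary integer operations executed so far. Only the
  operations below are charged; reading, overwriting or deleting an entry of the tuple is free.
\<close>

type_synonym 'a counted = "(nat, 'a) state"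

definition elementary :: "'a \<Rightarrow> 'a counted" where
  "elementary x = State (\<lambda>t. (x, Suc t))"

definition add_op :: "nat \<Rightarrow> nat \<Rightarrow> nat counted" where
  "add_op x y = elementary (x + y)"

definition sub_op :: "nat \<Rightarrow> nat \<Rightarrow> nat counted" where
  "sub_op x y = elementary (x - y)"

definition eq_op :: "nat \<Rightarrow> nat \<Rightarrow> bool counted" where
  "eq_op x y = elementary (x = y)"

definition less_op :: "nat \<Rightarrow> nat \<Rightarrow> bool counted" where
  "less_op x y = elementary (x < y)"

definition rem_op :: "nat \<Rightarrow> nat \<Rightarrow> nat counted" where
  "rem_op x y = elementary (x mod y)"

fun total :: "nat list \<Rightarrow> nat counted" where
  "total [] = State_Monad.return 0"
| "total (a # as) = do { s \<leftarrow> total as; add_op a s }"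

text \<open>
  In \<open>find_middle \<alpha> m L as\<close>, the list \<open>as\<close> is the part of the tuple that starts at index \<open>m\<close>, and
  \<open>L\<close> is the number of arcs before it. The result is the pair of the middle index and the number of
  arcs to its left. As the scan stops at the first \<open>m\<close> with \<open>\<alpha> \<le> 2 L(m + 1)\<close>, the condition
  \<open>2 L(m) < \<alpha>\<close> holds as well. The equation for the empty list is not reached on positive tuples.
\<close>

fun find_middle :: "nat \<Rightarrow> nat \<Rightarrow> nat \<Rightarrow> nat list \<Rightarrow> (nat \<times> nat) counted" where
  "find_middle \<alpha> m L [] = State_Monad.return (m, L)"
| "find_middle \<alpha> m L (a # as) = do {
     L' \<leftarrow> add_op L a;
     L2 \<leftarrow> add_op L' L';
     before \<leftarrow> less_op L2 \<alpha>;
     if before then do { m' \<leftarrow> add_op m 1; find_middle \<alpha> m' L' as }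
     else State_Monad.return (m, L)
   }"

text \<open>
  One application of the recursion to \<open>Z(as) + c\<close>, where \<open>c\<close> counts the components that have been
  split off. The subtractions never truncate when \<open>as\<close> is a nonempty positive tuple.
\<close>

definition recursion_step :: "nat list \<Rightarrow> nat \<Rightarrow> (nat list \<times> nat) counted" where
  "recursion_step as c = do {
     \<alpha> \<leftarrow> total as;
     (m, L) \<leftarrow> find_middle \<alpha> 0 0 as;
     \<beta> \<leftarrow> sub_op \<alpha> L;
     R \<leftarrow> sub_op \<beta> (as ! m);
     balanced \<leftarrow> eq_op L R;
     if balanced then do {
       c' \<leftarrow> add_op c (as ! m);
       State_Monad.return (delete_nth m as, c')
     } else do {
       right_heavy \<leftarrow> less_op L R;
       d \<leftarrow> (if right_heavy then sub_op R L else sub_op L R);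
       r \<leftarrow> rem_op (as ! m) d;
       divides \<leftarrow> eq_op r 0;
       if divides then State_Monad.return (delete_nth m as, c)
       else State_Monad.return (as[m := r], c)
     }
   }"

text \<open>
  The result is \<open>Some (z, t)\<close> if the iteration reaches the empty tuple, with output \<open>z\<close> after \<open>t\<close>
  elementary operations, and \<open>None\<close> if it does not terminate.
\<close>

definition count_components :: "nat list \<Rightarrow> (nat \<times> nat) option" where
  "count_components as =
     map_option (\<lambda>((_, c), t). (c, t))
       (while_option (\<lambda>((bs, _), _). bs \<noteq> [])
          (\<lambda>((bs, c), t). run_state (recursion_step bs c) t)
          ((as, 0), 0))"

definition input_bits :: "nat list \<Rightarrow> nat" where
  "input_bits as = (\<Sum>a\<leftarrow>as. nat \<lceil>log 2 (real a + 1)\<rceil>)"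

end

theory Submission
  imports Defs
begin

text \<open>
  Components of the meander correspond to orbits of its endpoints under the relation given by the
  arcs. Let \<open>L < R\<close> and \<open>d = R - L\<close>. The upper reflection of the middle family followed by the lower
  reflection is the translation by \<open>2 d\<close>, so every point of the middle family is equivalent to its
  translates. Hence only the residue of a middle point modulo \<open>2 d\<close> matters, and a middle family
  of size \<open>a + d\<close> gives as many orbits as one of size \<open>a\<close>. The case \<open>L > R\<close> is its mirror image.
  For \<open>L = R\<close> the middle family closes up with the lower arcs to concentric circles.

  For the complexity, the middle family satisfies \<open>\<bar>L - R\<bar> \<le> a\<close>, so a division with remainder more
  than halves it: every step costs \<open>O(n)\<close> operations and removes at least one input bit.
\<close>

subsection \<open>Orbits of planar arc systems\<close>

abbreviation equiv_hull :: "('a \<times> 'a) set \<Rightarrow> ('a \<times> 'a) set" where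
  "equiv_hull E \<equiv> (E \<union> E\<inverse>)\<^sup>*"

text \<open>Classes are formed with all of \<open>E\<close>, which may reach outside
  \<open>P\<close>; the set \<open>P\<close> only selects which classes are counted. So one relation
  can be counted on several sets of points.\<close>

definition orbits :: "('a \<times> 'a) set \<Rightarrow> 'a set \<Rightarrow> nat" where
  "orbits E P = card ((\<lambda>x. equiv_hull E `` {x}) ` P)"

lemma equiv_hull_edge: "(x, y) \<in> E \<Longrightarrow> (x, y) \<in> equiv_hull E"
  by blast

lemma equiv_hull_sym: "(x, y) \<in> equiv_hull E \<Longrightarrow> (y, x) \<in> equiv_hull E"
  by (metis converse_iff converse_Un converse_converse rtrancl_converse sup_commute)

lemma equiv_hull_class_eq_iff:
  "equiv_hull E `` {x} = equiv_hull E `` {y} \<longleftrightarrow> (x, y) \<in> equiv_hull E"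
  by (auto intro: rtrancl_trans dest: equiv_hull_sym)

lemma equiv_hull_map:
  assumes "(x, y) \<in> equiv_hull E"
    and "\<And>x y. (x, y) \<in> E \<Longrightarrow> (f x, f y) \<in> equiv_hull F"
  shows "(f x, f y) \<in> equiv_hull F"
  using assms(1)
proof induction
  case (step y z)
  then show ?case
    using assms(2) equiv_hull_sym by (metis Un_iff converse_iff rtrancl_trans)
qed simp

lemma equiv_hull_invariant:
  assumes "(x, y) \<in> equiv_hull E" and "\<And>x y. (x, y) \<in> E \<Longrightarrow> h x = h y"
  shows "h x = h y"
  using assms(1) by induction (use assms(2) in auto)

text \<open>Since \<open>f\<close> respects the relations, it induces a map from classes of
  \<open>E\<close> to classes of \<open>F\<close>. Up to equivalence \<open>g\<close> picks
  preimages, so every class meeting \<open>Q\<close> is hit. No compatibility of \<open>g\<close>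
  with the relations enters.\<close>

lemma orbits_le:
  assumes "finite P"
    and f: "\<And>x y. (x, y) \<in> E \<Longrightarrow> (f x, f y) \<in> equiv_hull F"
    and g: "\<And>y. y \<in> Q \<Longrightarrow> g y \<in> P"
    and fg: "\<And>y. y \<in> Q \<Longrightarrow> (f (g y), y) \<in> equiv_hull F"
  shows "orbits F Q \<le> orbits E P"
proof -
  let ?h = "\<lambda>x. equiv_hull E `` {x}" and ?k = "\<lambda>y. equiv_hull F `` {y}"
  \<comment> \<open>The induced map, defined through an arbitrary representative of the class; the
    next fact shows independence of the choice.\<close>
  let ?G = "\<lambda>C. ?k (f (SOME x. x \<in> C))"
  have G: "?G (?h x) = ?k (f x)" for x
  proof -
    have "(SOME z. z \<in> ?h x) \<in> ?h x"
      by (rule someI[of _ x]) simp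
    then have "(x, SOME z. z \<in> ?h x) \<in> equiv_hull E"
      by blast
    from equiv_hull_map[OF this f] show ?thesis
      unfolding equiv_hull_class_eq_iff by (rule equiv_hull_sym)
  qed
  have "?k ` Q \<subseteq> ?G ` ?h ` P"
  proof
    fix C assume "C \<in> ?k ` Q"
    then obtain y where y: "y \<in> Q" "C = ?k y" by blast
    have "C = ?k (f (g y))"
      unfolding y(2) equiv_hull_class_eq_iff by (rule equiv_hull_sym[OF fg[OF y(1)]])
    then have "C = ?G (?h (g y))" by (simp only: G)
    then show "C \<in> ?G ` ?h ` P"
      using g[OF y(1)] by (rule image_eqI[OF _ imageI])
  qed
  then have "card (?k ` Q) \<le> card (?G ` ?h ` P)"
    using assms(1) by (intro card_mono) auto
  also have "\<dots> \<le> card (?h ` P)"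
    using assms(1) by (intro card_image_le) auto
  finally show ?thesis by (simp add: orbits_def)
qed

text \<open>Two surjections between finite sets of classes. As \<open>f\<close> and \<open>g\<close>
  are inverse only up to equivalence, sets of points of different sizes can be compared.\<close>

lemma orbits_eqI:
  assumes "finite P" "finite Q" "\<And>x. x \<in> P \<Longrightarrow> f x \<in> Q" "\<And>y. y \<in> Q \<Longrightarrow> g y \<in> P"
    and "\<And>x y. (x, y) \<in> E \<Longrightarrow> (f x, f y) \<in> equiv_hull F"
    and "\<And>x y. (x, y) \<in> F \<Longrightarrow> (g x, g y) \<in> equiv_hull E"
    and "\<And>x. x \<in> P \<Longrightarrow> (g (f x), x) \<in> equiv_hull E"
    and "\<And>y. y \<in> Q \<Longrightarrow> (f (g y), y) \<in> equiv_hull F"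
  shows "orbits E P = orbits F Q"
  using orbits_le[of P E f F Q g] orbits_le[of Q F g E P f] assms by (meson order_antisym)

text \<open>Membership in \<open>P\<close> is constant along edges, so no class meets both
  \<open>P\<close> and \<open>Q\<close>.\<close>

lemma orbits_Un:
  assumes "finite P" "finite Q" "P \<inter> Q = {}" and "\<And>x y. (x, y) \<in> E \<Longrightarrow> x \<in> P \<longleftrightarrow> y \<in> P"
  shows "orbits E (P \<union> Q) = orbits E P + orbits E Q"
proof -
  have "equiv_hull E `` {x} \<noteq> equiv_hull E `` {y}" if "x \<in> P" "y \<in> Q" for x y
    unfolding equiv_hull_class_eq_iff
    using equiv_hull_invariant[of x y E "\<lambda>x. x \<in> P"] that assms by blast
  then show ?thesis
    unfolding orbits_def image_Un using assms by (intro card_Un_disjoint) auto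
qed

section \<open>Arc systems with a distinguished middle family\<close>

text \<open>The family of \<open>a\<close> arcs on the points following \<open>s\<close>, smaller
  endpoint first. The sum condition is a reflection; integers keep the reflections and shifts below
  free of truncation.\<close>

definition rainbow :: "int \<Rightarrow> int \<Rightarrow> (int \<times> int) set" where
  "rainbow s a = {(p, q). s < p \<and> p < q \<and> p + q = 2 * s + 2 * a + 1}"

text \<open>
  The family of size \<open>a\<close> is singled out: \<open>A\<close> and \<open>B\<close> are arbitrary configurations of upper arcs on
  the \<open>2 L\<close> points to its left and, counted from its right end, the \<open>2 R\<close> points to its right.
\<close>

definition arcs :: "(int \<times> int) set \<Rightarrow> int \<Rightarrow> int \<Rightarrow> (int \<times> int) set \<Rightarrow> int \<Rightarrow> (int \<times> int) set" where
  "arcs A L a B R = A \<union> rainbow (2 * L) a \<union> {(p, q). (p - 2 * L - 2 * a, q - 2 * L - 2 * a) \<in> B}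
     \<union> rainbow 0 (L + a + R)"

text \<open>The lower reflection without regard to which endpoint is the smaller one. The sum is
  odd, so no point is its own partner.\<close>

lemma arcs_lower:
  assumes "0 < p" "0 < q" "p + q = 2 * (L + a + R) + 1"
  shows "(p, q) \<in> equiv_hull (arcs A L a B R)"
proof (cases "p < q")
  case True
  then show ?thesis using assms by (intro equiv_hull_edge) (auto simp: arcs_def rainbow_def)
next
  case False
  moreover have "p \<noteq> q" using assms by presburger
  ultimately have "(q, p) \<in> arcs A L a B R" using assms by (auto simp: arcs_def rainbow_def)
  then show ?thesis by blast
qed

lemma arcs_middle:
  assumes "2 * L < p" "2 * L < q" "p + q = 4 * L + 2 * a + 1"
  shows "(p, q) \<in> equiv_hull (arcs A L a B R)"
proof (cases "p < q")
  case True
  then show ?thesis using assms by (intro equiv_hull_edge) (auto simp: arcs_def rainbow_def)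
next
  case False
  moreover have "p \<noteq> q" using assms by presburger
  ultimately have "(q, p) \<in> arcs A L a B R" using assms by (auto simp: arcs_def rainbow_def)
  then show ?thesis by blast
qed

text \<open>For \<open>L < R\<close> the composition of the two reflections is a translation by \<open>2 (R - L)\<close>.\<close>

lemma arcs_translate:
  assumes "0 \<le> L" "L < R" "2 * L < x" "x \<le> 2 * L + 2 * a"
  shows "(x, x + 2 * (R - L)) \<in> equiv_hull (arcs A L a B R)"
proof -
  have "(x, 4 * L + 2 * a + 1 - x) \<in> equiv_hull (arcs A L a B R)"
    using assms by (intro arcs_middle) auto
  moreover have "(4 * L + 2 * a + 1 - x, x + 2 * (R - L)) \<in> equiv_hull (arcs A L a B R)"
    using assms by (intro arcs_lower) auto
  ultimately show ?thesis by (rule rtrancl_trans)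
qed

lemma arcs_cases:
  assumes "(p, q) \<in> arcs A L a B R" "A \<subseteq> {1..2*L} \<times> {1..2*L}" "B \<subseteq> {1..2*R} \<times> {1..2*R}"
  obtains (left) "(p, q) \<in> A" "1 \<le> p" "p \<le> 2 * L" "1 \<le> q" "q \<le> 2 * L"
  | (mid) "2 * L < p" "p < q" "p + q = 4 * L + 2 * a + 1"
  | (right) "(p - 2 * L - 2 * a, q - 2 * L - 2 * a) \<in> B" "2 * L + 2 * a < p" "p \<le> 2 * L + 2 * a + 2 * R"
     "2 * L + 2 * a < q" "q \<le> 2 * L + 2 * a + 2 * R"
  | (lower) "0 < p" "p < q" "p + q = 2 * (L + a + R) + 1"
proof -
  from assms(1) consider "(p, q) \<in> A" | "(p, q) \<in> rainbow (2 * L) a"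
    | "(p - 2 * L - 2 * a, q - 2 * L - 2 * a) \<in> B" | "(p, q) \<in> rainbow 0 (L + a + R)"
    unfolding arcs_def by blast
  then show ?thesis
  proof cases
    case 1
    with assms(2) show ?thesis by (intro left) auto
  next
    case 2
    then show ?thesis by (intro mid) (auto simp: rainbow_def)
  next
    case 3
    with assms(3) have "p - 2 * L - 2 * a \<in> {1..2*R}" "q - 2 * L - 2 * a \<in> {1..2*R}" by blast+
    with 3 show ?thesis by (intro right) auto
  next
    case 4
    then show ?thesis by (intro lower) (auto simp: rainbow_def)
  qed
qed

text \<open>As \<open>R = L + d\<close>, the middle reflection of the larger system
  \<open>?F\<close> and the lower reflection of \<open>?E\<close> have the same sum
  \<open>4 * L + 2 * a + 2 * d + 1\<close>. The \<open>2 * d\<close> additional points of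
  \<open>?F\<close> are translates of other points, so identifying them loses no orbit.\<close>

lemma orbits_arcs_add:
  assumes "0 \<le> L" "0 \<le> a" and d: "0 < d" "R = L + d"
    and AB: "A \<subseteq> {1..2*L} \<times> {1..2*L}" "B \<subseteq> {1..2*R} \<times> {1..2*R}"
  shows "orbits (arcs A L (a + d) B R) {1..2 * (L + (a + d) + R)} = orbits (arcs A L a B R) {1..2 * (L + a + R)}"
    (is "orbits ?F ?Q = orbits ?E ?P")
proof -
  \<comment> \<open>\<open>?f\<close> opens a gap of \<open>2 * d\<close> points right after the
    left families. \<open>?g\<close> keeps the first \<open>2 * d\<close> middle points and moves
    all later ones back. Then \<open>?g\<close> undoes \<open>?f\<close>, while \<open>?f\<close>
    after \<open>?g\<close> shifts exactly those first middle points by \<open>2 * d\<close>, which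
    \<open>TF\<close> permits.\<close>
  let ?f = "\<lambda>x. if x \<le> 2 * L then x else x + 2 * d"
  let ?g = "\<lambda>y. if y \<le> 2 * L + 2 * d then y else y - 2 * d"
  have TE: "(x, x + 2 * d) \<in> equiv_hull ?E" if "2 * L < x" "x \<le> 2 * L + 2 * a" for x
    using arcs_translate[of L R x a A B] that assms by simp
  have TF: "(x, x + 2 * d) \<in> equiv_hull ?F" if "2 * L < x" "x \<le> 2 * L + 2 * (a + d)" for x
    using arcs_translate[of L R x "a + d" A B] that assms by simp
  have G: "(?g y, y) \<in> equiv_hull ?E" if "2 * L < y" "y \<le> 2 * L + 2 * a + 2 * d" for y
    using TE[of "y - 2 * d"] that by auto
  have f: "(?f p, ?f q) \<in> equiv_hull ?F" if "(p, q) \<in> ?E" for p q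
    using that AB
  proof (cases rule: arcs_cases)
    case left
    then show ?thesis by (intro equiv_hull_edge) (auto simp: arcs_def)
  next
    case mid
    \<comment> \<open>Shifting both endpoints turns the sum \<open>4 * L + 2 * a + 1\<close> into
      the sum of the lower reflection of \<open>?F\<close>.\<close>
    then have "(p + 2 * d, q + 2 * d) \<in> equiv_hull ?F"
      using assms by (intro arcs_lower) auto
    then show ?thesis using mid by simp
  next
    case right
    then show ?thesis using assms by (intro equiv_hull_edge) (auto simp: arcs_def algebra_simps)
  next
    case lower
    show ?thesis
    proof (cases "p \<le> 2 * L")
      case True
      then have "(p, q + 2 * d) \<in> equiv_hull ?F"
        using lower assms by (intro arcs_lower) auto
      moreover have "\<not> q \<le> 2 * L" using True lower assms by auto
      ultimately show ?thesis using True by simp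
    next
      case False
      \<comment> \<open>Both endpoints get shifted here, which is \<open>2 * d\<close> too much for
        a lower arc of \<open>?F\<close>; a translation of \<open>q\<close> makes up for it.\<close>
      have "(p + 2 * d, q) \<in> equiv_hull ?F"
        using lower assms by (intro arcs_lower) auto
      moreover have "(q, q + 2 * d) \<in> equiv_hull ?F"
        using lower assms False by (intro TF) auto
      ultimately have "(p + 2 * d, q + 2 * d) \<in> equiv_hull ?F" by (rule rtrancl_trans)
      then show ?thesis using False lower by auto
    qed
  qed
  have g: "(?g p, ?g q) \<in> equiv_hull ?E" if "(p, q) \<in> ?F" for p q
    using that AB
  proof (cases rule: arcs_cases)
    case left
    then show ?thesis using assms by (intro equiv_hull_edge) (auto simp: arcs_def)
  next
    case mid
    \<comment> \<open>Undo \<open>?g\<close> by translations in \<open>?E\<close>; in between, the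
      middle arc of \<open>?F\<close> is a lower arc of \<open>?E\<close>.\<close>
    have "(?g p, p) \<in> equiv_hull ?E" using mid assms by (intro G) auto
    also have "(p, q) \<in> equiv_hull ?E" using mid assms by (intro arcs_lower) auto
    also have "(q, ?g q) \<in> equiv_hull ?E" using mid assms by (intro equiv_hull_sym[OF G]) auto
    finally show ?thesis .
  next
    case right
    then show ?thesis using assms by (intro equiv_hull_edge) (auto simp: arcs_def algebra_simps)
  next
    case lower
    have "(?g p, p) \<in> equiv_hull ?E"
    proof (cases "p \<le> 2 * L")
      case False
      then show ?thesis using lower assms by (intro G) auto
    qed (use d in auto)
    also have "(p, q - 2 * d) \<in> equiv_hull ?E" using lower assms by (intro arcs_lower) auto
    also have "q - 2 * d = ?g q" using lower assms by auto
    finally show ?thesis .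
  qed
  have fg: "(?f (?g y), y) \<in> equiv_hull ?F" for y
    using equiv_hull_sym[OF TF[of y]] assms by auto
  have "orbits ?E ?P = orbits ?F ?Q"
    by (rule orbits_eqI[of _ _ ?f ?g]) (use f g fg assms in auto)
  then show ?thesis by simp
qed

text \<open>Removes \<open>R - L\<close> from the middle family as often as the quotient says, by
  induction on that number.\<close>

lemma orbits_arcs_mod_less:
  assumes "0 \<le> L" "L < R" "0 \<le> a" "A \<subseteq> {1..2*L} \<times> {1..2*L}" "B \<subseteq> {1..2*R} \<times> {1..2*R}"
  shows "orbits (arcs A L a B R) {1..2 * (L + a + R)} =
    orbits (arcs A L (a mod (R - L)) B R) {1..2 * (L + a mod (R - L) + R)}"
proof -
  let ?d = "R - L"
  have "orbits (arcs A L (a mod ?d + int k * ?d) B R) {1..2 * (L + (a mod ?d + int k * ?d) + R)} =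
    orbits (arcs A L (a mod ?d) B R) {1..2 * (L + a mod ?d + R)}" for k
  proof (induction k)
    case (Suc k)
    have *: "a mod ?d + int (Suc k) * ?d = (a mod ?d + int k * ?d) + ?d"
      by (simp add: algebra_simps)
    show ?case
      unfolding * Suc[symmetric] using assms by (intro orbits_arcs_add) auto
  qed simp
  from this[of "nat (a div ?d)"] show ?thesis
    using assms by (simp only: pos_imp_zdiv_nonneg_iff diff_gt_0_iff_gt int_nat_eq if_True mod_div_mult_eq)
qed

text \<open>Reflection of \<open>2 * L\<close> points. It puts the larger endpoint first, which is
  harmless because the hull is symmetric and \<open>arcs\<close> accepts arbitrary relations beside
  the middle family.\<close>

definition mirror :: "int \<Rightarrow> (int \<times> int) set \<Rightarrow> (int \<times> int) set" where
  "mirror L A = {(p, q). (2 * L + 1 - p, 2 * L + 1 - q) \<in> A}"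

text \<open>The reflection of all points is an involution that swaps the two outer configurations
  and carries middle and lower arcs to such arcs again.\<close>

lemma orbits_arcs_mirror:
  assumes "0 \<le> L" "0 \<le> R" "0 \<le> a" and AB: "A \<subseteq> {1..2*L} \<times> {1..2*L}" "B \<subseteq> {1..2*R} \<times> {1..2*R}"
  shows "orbits (arcs A L a B R) {1..2 * (L + a + R)} =
    orbits (arcs (mirror R B) R a (mirror L A) L) {1..2 * (R + a + L)}"
proof -
  have M: "mirror L A \<subseteq> {1..2*L} \<times> {1..2*L}" "mirror R B \<subseteq> {1..2*R} \<times> {1..2*R}"
    using AB by (fastforce simp: mirror_def)+
  let ?f = "\<lambda>x. 2 * (L + a + R) + 1 - x"
  have *: "(?f p, ?f q) \<in> equiv_hull (arcs (mirror R B) R a (mirror L A) L)"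
    if "(p, q) \<in> arcs A L a B R" for p q
    using that AB
  proof (cases rule: arcs_cases)
    case left
    then show ?thesis by (intro equiv_hull_edge) (auto simp: arcs_def mirror_def)
  next
    case right
    then show ?thesis by (intro equiv_hull_edge) (auto simp: arcs_def mirror_def algebra_simps)
  next
    case mid
    then show ?thesis by (intro arcs_middle) auto
  next
    case lower
    then show ?thesis by (intro arcs_lower) auto
  qed
  have **: "(?f p, ?f q) \<in> equiv_hull (arcs A L a B R)"
    if "(p, q) \<in> arcs (mirror R B) R a (mirror L A) L" for p q
    using that M(2,1)
  proof (cases rule: arcs_cases)
    case left
    then show ?thesis by (intro equiv_hull_edge) (auto simp: arcs_def mirror_def algebra_simps)
  next
    case right
    then show ?thesis by (intro equiv_hull_edge) (auto simp: arcs_def mirror_def algebra_simps)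
  next
    case mid
    then show ?thesis by (intro arcs_middle) auto
  next
    case lower
    then show ?thesis by (intro arcs_lower) auto
  qed
  show ?thesis
    by (rule orbits_eqI[of _ _ ?f ?f]) (use * ** in auto)
qed

text \<open>For \<open>L > R\<close>, both sides are replaced by their mirror images, where the
  previous case applies.\<close>

lemma orbits_arcs_mod:
  assumes "0 \<le> L" "0 \<le> R" "0 \<le> a" "L \<noteq> R" and AB: "A \<subseteq> {1..2*L} \<times> {1..2*L}" "B \<subseteq> {1..2*R} \<times> {1..2*R}"
  shows "orbits (arcs A L a B R) {1..2 * (L + a + R)} =
    orbits (arcs A L (a mod \<bar>L - R\<bar>) B R) {1..2 * (L + a mod \<bar>L - R\<bar> + R)}"
proof (cases "L < R")
  case True
  then have "\<bar>L - R\<bar> = R - L" by simp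
  then show ?thesis
    using orbits_arcs_mod_less[of L R a A B] assms True by simp
next
  case False
  then have *: "\<bar>L - R\<bar> = L - R" by simp
  have M: "mirror L A \<subseteq> {1..2*L} \<times> {1..2*L}" "mirror R B \<subseteq> {1..2*R} \<times> {1..2*R}"
    using AB by (fastforce simp: mirror_def)+
  show ?thesis
    using orbits_arcs_mod_less[OF _ _ _ M(2,1), of a] assms False
      orbits_arcs_mirror[of L R a A B] orbits_arcs_mirror[of L R "a mod (L - R)" A B]
    by (simp add: *)
qed

text \<open>The middle and the lower reflection now have the same axis, so they agree on the middle
  points. These form \<open>a\<close> orbits of two points each, and no edge joins them to the rest,
  where the gap can be closed.\<close>

lemma orbits_arcs_balanced:
  assumes "0 \<le> L" "0 \<le> a" and AB: "A \<subseteq> {1..2*L} \<times> {1..2*L}" "B \<subseteq> {1..2*L} \<times> {1..2*L}"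
  shows "orbits (arcs A L a B L) {1..2 * (L + a + L)} =
    orbits (arcs A L 0 B L) {1..2 * (L + 0 + L)} + nat a"
    (is "orbits ?E _ = orbits ?F ?Q + _")
proof -
  let ?M = "{2 * L + 1..2 * L + 2 * a}" and ?O = "{1..2 * L} \<union> {2 * L + 2 * a + 1..4 * L + 2 * a}"
  have P: "{1..2 * (L + a + L)} = ?M \<union> ?O" using assms by auto
  have "orbits ?E (?M \<union> ?O) = orbits ?E ?M + orbits ?E ?O"
  proof (rule orbits_Un)
    fix p q assume "(p, q) \<in> ?E"
    then show "p \<in> ?M \<longleftrightarrow> q \<in> ?M" using AB
      by (cases rule: arcs_cases) auto
  qed auto
  moreover have "orbits ?E ?M = nat a"
  proof -
    let ?c = "\<lambda>x. equiv_hull ?E `` {x}" and ?H = "{2 * L + 1..2 * L + a}"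
    \<comment> \<open>An invariant of orbits: the left endpoint of the circle through a middle
      point, and the dummy 0 elsewhere. It separates the points of \<open>?H\<close>.\<close>
    let ?h = "\<lambda>x. if x \<in> ?M then min x (4 * L + 2 * a + 1 - x) else 0"
    have "?c ` ?M = ?c ` ?H"
    proof
      show "?c ` ?M \<subseteq> ?c ` ?H"
      proof
        fix C assume "C \<in> ?c ` ?M"
        then obtain x where x: "x \<in> ?M" "C = ?c x" by blast
        have *: "?c x = ?c (4 * L + 2 * a + 1 - x)"
          unfolding equiv_hull_class_eq_iff using x by (intro arcs_middle) auto
        show "C \<in> ?c ` ?H"
        proof (cases "x \<in> ?H")
          case False
          with x have "4 * L + 2 * a + 1 - x \<in> ?H" by auto
          then show ?thesis unfolding x * by (rule imageI)
        qed (use x in blast)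
      qed
      show "?c ` ?H \<subseteq> ?c ` ?M"
        using assms by (intro image_mono) auto
    qed
    moreover have "inj_on ?c ?H"
    proof (rule inj_onI)
      fix x y assume xy: "x \<in> ?H" "y \<in> ?H" "?c x = ?c y"
      then have "(x, y) \<in> equiv_hull ?E" by (simp only: equiv_hull_class_eq_iff)
      then have "?h x = ?h y"
      proof (rule equiv_hull_invariant)
        fix p q assume "(p, q) \<in> ?E"
        then show "?h p = ?h q" using AB
          by (cases rule: arcs_cases) (auto simp: min_def)
      qed
      then show "x = y" using xy by (auto simp: min_def split: if_splits)
    qed
    ultimately show ?thesis
      using assms by (simp add: orbits_def card_image)
  qed
  moreover have "orbits ?E ?O = orbits ?F ?Q"
  \<comment> \<open>The first map must respect all edges of \<open>?E\<close>, including those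
    between middle points. Sending all middle points to 0 makes these edges trivial.\<close>
  proof (rule orbits_eqI[of _ _ "\<lambda>x. if x \<le> 2 * L then x else if x \<le> 2 * L + 2 * a then 0 else x - 2 * a"
        "\<lambda>x. if x \<le> 2 * L then x else x + 2 * a"], goal_cases)
    case (5 p q)
    then show ?case using AB
    proof (cases rule: arcs_cases)
      case left
      then show ?thesis by (intro equiv_hull_edge) (auto simp: arcs_def)
    next
      case right
      then show ?thesis using assms by (intro equiv_hull_edge) (auto simp: arcs_def algebra_simps)
    next
      case lower
      then show ?thesis using assms by (auto intro!: arcs_lower)
    qed auto
  next
    case (6 p q)
    then show ?case using AB
    proof (cases rule: arcs_cases)
      case left
      then show ?thesis by (intro equiv_hull_edge) (auto simp: arcs_def)
    next
      case right
      then show ?thesis using assms by (intro equiv_hull_edge) (auto simp: arcs_def algebra_simps)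
    next
      case lower
      then show ?thesis using assms by (auto intro!: arcs_lower)
    qed auto
  qed (use assms in \<open>auto split: if_splits\<close>)
  ultimately show ?thesis using P by simp
qed

subsection \<open>Half circles\<close>

text \<open>The half circle is the image of an interval under a continuous parametrization by the
  horizontal offset \<open>t\<close> from the centre. For \<open>q < p\<close> the radius is
  negative and the set empty.\<close>

lemma connected_upper_arc: "connected (upper_arc p q)"
proof (cases "q < p")
  case True
  have "z \<notin> upper_arc p q" for z
    using True zero_le_dist[of z "complex_of_real ((real p + real q) / 2)"]
    unfolding upper_arc_def by (simp del: zero_le_dist)
  then have "upper_arc p q = {}" by blast
  then show ?thesis by simp
next
  case False
  define c r where "c = (real p + real q) / 2" and "r = (real q - real p) / 2"
  have r: "0 \<le> r" using False by (simp add: r_def)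
  have "upper_arc p q = (\<lambda>t. Complex (c + t) (sqrt (r\<^sup>2 - t\<^sup>2))) ` {-r..r}" (is "_ = ?f ` _")
  proof (intro subset_antisym subsetI)
    fix z assume "z \<in> upper_arc p q"
    then have z: "0 \<le> Im z" "sqrt ((Re z - c)\<^sup>2 + (Im z)\<^sup>2) = r"
      by (auto simp: upper_arc_def c_def r_def dist_norm cmod_def)
    then have *: "(Re z - c)\<^sup>2 + (Im z)\<^sup>2 = r\<^sup>2"
      using r by (metis real_sqrt_pow2 sum_power2_ge_zero)
    then have "\<bar>Re z - c\<bar> \<le> r"
      using r by (metis abs_le_square_iff abs_of_nonneg le_add_same_cancel1 zero_le_power2)
    moreover have "Im z = sqrt (r\<^sup>2 - (Re z - c)\<^sup>2)"
      using z(1) by (simp flip: *)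
    ultimately show "z \<in> ?f ` {-r..r}"
      by (intro image_eqI[of _ _ "Re z - c"]) (auto simp: complex_eq_iff)
  next
    fix z assume "z \<in> ?f ` {-r..r}"
    then obtain t where t: "-r \<le> t" "t \<le> r" "z = ?f t" by auto
    then have "t\<^sup>2 \<le> r\<^sup>2" by (intro abs_le_square_iff[THEN iffD1]) auto
    then show "z \<in> upper_arc p q"
      using r t by (auto simp: upper_arc_def dist_norm cmod_def simp flip: c_def r_def)
  qed
  moreover have "connected (?f ` {-r..r})"
    by (intro connected_continuous_image continuous_on_Complex continuous_intros) auto
  ultimately show ?thesis by simp
qed

text \<open>Conjugation fixes the real centre and preserves distances, so facts about upper arcs
  carry over to lower arcs.\<close>

lemma lower_arc_eq_cnj: "lower_arc p q = cnj ` upper_arc p q"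
proof -
  have *: "dist (cnj z) (complex_of_real x) = dist z (complex_of_real x)" for z x
    by (metis complex_cnj_complex_of_real complex_cnj_diff complex_mod_cnj dist_norm)
  then have "z \<in> lower_arc p q \<longleftrightarrow> cnj z \<in> upper_arc p q" for z
    unfolding lower_arc_def upper_arc_def mem_Collect_eq
    by (simp only: * cnj.sel neg_0_le_iff_le)
  then show ?thesis
    unfolding set_eq_iff image_iff by (metis complex_cnj_cnj)
qed

lemma connected_lower_arc: "connected (lower_arc p q)"
  unfolding lower_arc_eq_cnj
  by (intro connected_continuous_image connected_upper_arc continuous_intros)

lemma closed_upper_arc: "closed (upper_arc p q)"
  unfolding upper_arc_def by (intro closed_Collect_conj closed_Collect_le closed_Collect_eq continuous_intros)

lemma closed_lower_arc: "closed (lower_arc p q)"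
  unfolding lower_arc_def by (intro closed_Collect_conj closed_Collect_le closed_Collect_eq continuous_intros)

lemma endpoints_in_upper_arc: "p \<le> q \<Longrightarrow> of_nat p \<in> upper_arc p q" "p \<le> q \<Longrightarrow> of_nat q \<in> upper_arc p q"
  by (auto simp: upper_arc_def dist_norm cmod_def real_sqrt_divide real_sqrt_abs field_simps)

lemma endpoints_in_lower_arc: "p \<le> q \<Longrightarrow> of_nat p \<in> lower_arc p q" "p \<le> q \<Longrightarrow> of_nat q \<in> lower_arc p q"
  by (auto simp: lower_arc_def dist_norm cmod_def real_sqrt_divide real_sqrt_abs field_simps)

text \<open>The real part of a point on an arc lies between the two endpoints.\<close>

lemma disjnt_upper_arc_side:
  assumes "q < p'"
  shows "upper_arc p q \<inter> upper_arc p' q' = {}"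
proof -
  have "Re z \<le> real q" "real p \<le> Re z" if "z \<in> upper_arc p q" for z p q
  proof -
    have "\<bar>Re z - (real p + real q) / 2\<bar> \<le> (real q - real p) / 2"
      using that abs_Re_le_cmod[of "z - complex_of_real ((real p + real q) / 2)"]
      by (auto simp: upper_arc_def dist_norm)
    then show "Re z \<le> real q" "real p \<le> Re z" by (auto simp: abs_if field_simps split: if_splits)
  qed
  then show ?thesis using assms by force
qed

text \<open>At a common point the triangle inequality would bound the outer radius by the inner
  radius plus the distance of the centres, against the strict inclusion of the intervals.\<close>

lemma disjnt_upper_arc_nested:
  assumes "p < p'" "q' < q"
  shows "upper_arc p q \<inter> upper_arc p' q' = {}"
proof (rule ccontr)
  let ?c = "(real p + real q) / 2" and ?c' = "(real p' + real q') / 2"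
  assume "upper_arc p q \<inter> upper_arc p' q' \<noteq> {}"
  then obtain z where "dist z (complex_of_real ?c) = (real q - real p) / 2"
    "dist z (complex_of_real ?c') = (real q' - real p') / 2"
    by (auto simp: upper_arc_def)
  moreover have "dist (complex_of_real ?c') (complex_of_real ?c) = \<bar>?c' - ?c\<bar>"
    unfolding dist_norm by (metis norm_of_real of_real_diff)
  ultimately have "(real q - real p) / 2 \<le> (real q' - real p') / 2 + \<bar>?c' - ?c\<bar>"
    using dist_triangle[of z "complex_of_real ?c" "complex_of_real ?c'"] by linarith
  then show False using assms by (auto simp: abs_if field_simps split: if_splits)
qed

text \<open>A common point has imaginary part 0, and a half circle meets the axis only at its
  endpoints.\<close>

lemma upper_arc_Int_lower_arc:
  assumes "z \<in> upper_arc p q" "z \<in> lower_arc p' q'"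
  shows "z \<in> {of_nat p, of_nat q} \<inter> {of_nat p', of_nat q'}"
proof -
  have [simp]: "Im z = 0" using assms by (auto simp: upper_arc_def lower_arc_def)
  have "\<bar>Re z - (real p + real q) / 2\<bar> = (real q - real p) / 2"
    using assms(1) by (simp add: upper_arc_def dist_norm cmod_def)
  then have 1: "Re z = real p \<or> Re z = real q"
    by (auto simp: abs_if field_simps split: if_splits)
  have "\<bar>Re z - (real p' + real q') / 2\<bar> = (real q' - real p') / 2"
    using assms(2) by (simp add: lower_arc_def dist_norm cmod_def)
  then have "Re z = real p' \<or> Re z = real q'"
    by (auto simp: abs_if field_simps split: if_splits)
  with 1 show ?thesis by (auto simp: complex_eq_iff)
qed

subsection \<open>Components as orbits\<close>

text \<open>Components of a finite union of closed connected pieces correspond to classes of the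
  intersection graph. Over one class the pieces form chains, so their union is connected; the
  remaining pieces have a closed union, disjoint from it by \<open>sep\<close>.\<close>

lemma card_components_UN:
  fixes K :: "'i \<Rightarrow> 'b::topological_space set"
  assumes "finite P" "E \<subseteq> P \<times> P"
    and conn: "\<And>x. x \<in> P \<Longrightarrow> connected (K x)" and clos: "\<And>x. x \<in> P \<Longrightarrow> closed (K x)"
    and ne: "\<And>x. x \<in> P \<Longrightarrow> K x \<noteq> {}"
    and adj: "\<And>x y. (x, y) \<in> E \<Longrightarrow> K x \<inter> K y \<noteq> {}"
    and sep: "\<And>x y. x \<in> P \<Longrightarrow> y \<in> P \<Longrightarrow> K x \<inter> K y \<noteq> {} \<Longrightarrow> (x, y) \<in> equiv_hull E"
  shows "card (components (\<Union>x\<in>P. K x)) = orbits E P"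
proof -
  let ?U = "\<Union>x\<in>P. K x" and ?C = "\<lambda>x. equiv_hull E `` {x}"
  define S where "S = (\<lambda>C. \<Union>y\<in>C. K y)"
  have CP: "?C x \<subseteq> P" if "x \<in> P" for x
  proof
    fix y assume "y \<in> ?C x"
    then have "(x, y) \<in> equiv_hull E" by simp
    then show "y \<in> P" by (induction) (use that assms(2) in auto)
  qed
  have comp: "connected_component_set ?U a = S (?C x)" if x: "x \<in> P" and a: "a \<in> K x" for a x
  proof
    \<comment> \<open>Induction along a chain of edges: consecutive pieces share a point
      \<open>c\<close> through which the connection passes.\<close>
    have "connected_component (S (?C x)) a b" if "(x, y) \<in> equiv_hull E" "b \<in> K y" for b y
      using that
    proof (induction arbitrary: b)
      case base
      then show ?case
        using connected_component_of_subset[of "K x" a b "S (?C x)"] conn[OF x] a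
        by (force simp: S_def connected_iff_connected_component)
    next
      case (step y z)
      then have z: "z \<in> ?C x" by (simp add: rtrancl.rtrancl_into_rtrancl)
      with CP x have "connected (K z)" using conn by blast
      have "K y \<inter> K z \<noteq> {}" using step(2) adj by (auto dest: adj)
      then obtain c where c: "c \<in> K y" "c \<in> K z" by blast
      have "connected_component (S (?C x)) a c" using step.IH c by blast
      moreover have "connected_component (S (?C x)) c b"
      proof (rule connected_component_of_subset[of "K z"])
        show "connected_component (K z) c b"
          using \<open>connected (K z)\<close> c step(4) by (simp add: connected_iff_connected_component)
        show "K z \<subseteq> S (?C x)" using z unfolding S_def by blast
      qed
      ultimately show ?case by (rule connected_component_trans)
    qed
    then have *: "connected_component (S (?C x)) a b" if "b \<in> S (?C x)" for b
      using that unfolding S_def by blast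
    show "S (?C x) \<subseteq> connected_component_set ?U a"
    proof
      fix b assume "b \<in> S (?C x)"
      from *[OF this] have "connected_component ?U a b"
        by (rule connected_component_of_subset) (use CP[OF x] in \<open>auto simp: S_def\<close>)
      then show "b \<in> connected_component_set ?U a" by simp
    qed
    \<comment> \<open>The connected set \<open>?W\<close> is covered by two disjoint closed sets and
      contains \<open>a\<close>, so it lies in the one containing \<open>a\<close>.\<close>
    let ?W = "connected_component_set ?U a" and ?T = "S (P - ?C x)"
    have "?W \<subseteq> ?U" by (rule connected_component_subset)
    then have "?W \<subseteq> S (?C x) \<union> ?T" unfolding S_def by blast
    moreover have "closed (S (?C x))" "closed ?T"
      unfolding S_def using CP[OF x] assms(1) clos by (auto intro!: closed_UN finite_subset[of _ P])
    moreover have "S (?C x) \<inter> ?T = {}"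
    proof -
      have False if "y \<in> ?C x" "z \<in> P" "z \<notin> ?C x" "K y \<inter> K z \<noteq> {}" for y z
      proof -
        have "(y, z) \<in> equiv_hull E" using that CP[OF x] by (intro sep) auto
        with that(1) have "z \<in> ?C x" by (auto intro: rtrancl_trans)
        with that show False by blast
      qed
      then show ?thesis unfolding S_def by blast
    qed
    moreover have "a \<in> ?W" using x a by (auto simp: connected_component_refl_eq)
    moreover have "a \<in> S (?C x)" using a unfolding S_def by blast
    ultimately have "?T \<inter> ?W = {}"
      using connected_connected_component[of ?U a] unfolding connected_closed by blast
    with \<open>?W \<subseteq> S (?C x) \<union> ?T\<close> show "?W \<subseteq> S (?C x)" by blast
  qed
  have "components ?U = S ` ?C ` P"
  proof
    show "components ?U \<subseteq> S ` ?C ` P"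
      using comp unfolding components_def by blast
    show "S ` ?C ` P \<subseteq> components ?U"
    proof
      fix V assume "V \<in> S ` ?C ` P"
      then obtain x where x: "x \<in> P" "V = S (?C x)" by blast
      with ne obtain a where a: "a \<in> K x" by blast
      with x have "V = connected_component_set ?U a" "a \<in> ?U" using comp by auto
      then show "V \<in> components ?U" unfolding components_def by blast
    qed
  qed
  \<comment> \<open>Pieces are nonempty, so equal unions have a common point, and \<open>sep\<close>
    links the two classes.\<close>
  moreover have "inj_on S (?C ` P)"
  proof (rule inj_onI)
    fix X Y assume "X \<in> ?C ` P" "Y \<in> ?C ` P" and eq: "S X = S Y"
    then obtain x y where x: "x \<in> P" "X = ?C x" and y: "y \<in> P" "Y = ?C y" by blast
    from ne x obtain a where a: "a \<in> K x" by blast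
    then have "a \<in> S X" unfolding S_def x by blast
    with eq obtain z where z: "z \<in> ?C y" "a \<in> K z" unfolding S_def y by blast
    then have "(x, z) \<in> equiv_hull E" using CP[OF y(1)] x a by (intro sep) auto
    with z have "(x, y) \<in> equiv_hull E" by (auto intro: rtrancl_trans dest: equiv_hull_sym)
    then show "X = Y" unfolding x y equiv_hull_class_eq_iff .
  qed
  ultimately show ?thesis by (simp add: orbits_def card_image)
qed

text \<open>Equal, side by side or nested. The strict inequalities also exclude shared endpoints of
  distinct arcs, so that distinct half circles are disjoint as sets.\<close>

definition noncrossing :: "(int \<times> int) set \<Rightarrow> bool" where
  "noncrossing U \<longleftrightarrow> (\<forall>p q p' q'. (p, q) \<in> U \<longrightarrow> (p', q') \<in> U \<longrightarrow>
     (p, q) = (p', q') \<or> q < p' \<or> q' < p \<or> p < p' \<and> q' < q \<or> p' < p \<and> q < q')"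

lemma noncrossing_upper_arc_eq:
  assumes "noncrossing U" "(p, q) \<in> U" "(p', q') \<in> U" "0 \<le> p" "0 \<le> p'" "p < q" "p' < q'"
    and "upper_arc (nat p) (nat q) \<inter> upper_arc (nat p') (nat q') \<noteq> {}"
  shows "(p', q') = (p, q)"
proof -
  have "(p, q) = (p', q') \<or> q < p' \<or> q' < p \<or> p < p' \<and> q' < q \<or> p' < p \<and> q < q'"
    using assms(1-3) unfolding noncrossing_def by blast
  then show ?thesis
  proof (elim disjE conjE)
    assume "q < p'"
    then have "nat q < nat p'" using assms by simp
    then show ?thesis using disjnt_upper_arc_side assms(8) by blast
  next
    assume "q' < p"
    then have "nat q' < nat p" using assms by simp
    then show ?thesis using disjnt_upper_arc_side assms(8) by blast
  next
    assume "p < p'" "q' < q"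
    then have "nat p < nat p'" "nat q' < nat q" using assms by simp_all
    then show ?thesis using disjnt_upper_arc_nested assms(8) by blast
  next
    assume "p' < p" "q < q'"
    then have "nat p' < nat p" "nat q < nat q'" using assms by simp_all
    then show ?thesis using disjnt_upper_arc_nested assms(8) by blast
  qed simp
qed

lemma noncrossing_lower_arc_eq:
  assumes "noncrossing U" "(p, q) \<in> U" "(p', q') \<in> U" "0 \<le> p" "0 \<le> p'" "p < q" "p' < q'"
    and "lower_arc (nat p) (nat q) \<inter> lower_arc (nat p') (nat q') \<noteq> {}"
  shows "(p', q') = (p, q)"
  using assms(1-7)
proof (rule noncrossing_upper_arc_eq)
  show "upper_arc (nat p) (nat q) \<inter> upper_arc (nat p') (nat q') \<noteq> {}"
    using assms(8) by (auto simp: lower_arc_eq_cnj)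
qed

lemma equiv_hull_endpoints:
  "(p, q) \<in> E \<Longrightarrow> x = p \<or> x = q \<Longrightarrow> y = p \<or> y = q \<Longrightarrow> (x, y) \<in> equiv_hull E"
  by blast

text \<open>The piece attached to a point consists of all arcs ending there, so each arc lies in the
  pieces of both its endpoints. Conversely, two pieces that meet share an arc, or an upper and a
  lower arc with a common endpoint.\<close>

lemma card_components_arcs:
  assumes U: "\<And>p q. (p, q) \<in> U \<Longrightarrow> 1 \<le> p \<and> p < q \<and> q \<le> N" "noncrossing U"
    and D: "\<And>p q. (p, q) \<in> D \<Longrightarrow> 1 \<le> p \<and> p < q \<and> q \<le> N" "noncrossing D"
    and cover: "\<And>x. 1 \<le> x \<Longrightarrow> x \<le> N \<Longrightarrow> \<exists>(p, q)\<in>U. x = p \<or> x = q"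
  shows "card (components ((\<Union>(p, q)\<in>U. upper_arc (nat p) (nat q)) \<union> (\<Union>(p, q)\<in>D. lower_arc (nat p) (nat q))))
    = orbits (U \<union> D) {1..N}"
proof -
  define KU where "KU = (\<lambda>x. \<Union>(p, q)\<in>{(p, q)\<in>U. x = p \<or> x = q}. upper_arc (nat p) (nat q))"
  define KD where "KD = (\<lambda>x. \<Union>(p, q)\<in>{(p, q)\<in>D. x = p \<or> x = q}. lower_arc (nat p) (nat q))"
  have "U \<subseteq> {1..N} \<times> {1..N}" "D \<subseteq> {1..N} \<times> {1..N}" using U D by fastforce+
  then have fin: "finite U" "finite D" by (auto intro: finite_subset)
  have point: "of_nat (nat x) \<in> upper_arc (nat p) (nat q)" if "(p, q) \<in> U" "x = p \<or> x = q" for p q x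
    using U(1)[OF that(1)] that(2) endpoints_in_upper_arc[of "nat p" "nat q"] by auto
  have point': "of_nat (nat x) \<in> lower_arc (nat p) (nat q)" if "(p, q) \<in> D" "x = p \<or> x = q" for p q x
    using D(1)[OF that(1)] that(2) endpoints_in_lower_arc[of "nat p" "nat q"] by auto
  have inK: "of_nat (nat x) \<in> KU x" if "x \<in> {1..N}" for x
    using cover[of x] that point unfolding KU_def by fastforce
  have "(\<Union>(p, q)\<in>U. upper_arc (nat p) (nat q)) \<union> (\<Union>(p, q)\<in>D. lower_arc (nat p) (nat q))
      = (\<Union>x\<in>{1..N}. KU x \<union> KD x)" (is "?M = ?N")
  proof
    show "?M \<subseteq> ?N"
      unfolding KU_def KD_def using U(1) D(1) by fastforce
    show "?N \<subseteq> ?M" unfolding KU_def KD_def by blast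
  qed
  moreover have "card (components (\<Union>x\<in>{1..N}. KU x \<union> KD x)) = orbits (U \<union> D) {1..N}"
  proof (rule card_components_UN)
    fix x assume x: "x \<in> {1..N}"
    \<comment> \<open>All arcs ending at \<open>x\<close> pass through the point \<open>x\<close>,
      so their union is connected.\<close>
    have "(\<Inter>(p, q)\<in>{(p, q)\<in>U. x = p \<or> x = q}. upper_arc (nat p) (nat q)) \<noteq> {}"
      using point by (intro ex_in_conv[THEN iffD1] exI[of _ "of_nat (nat x)"]) auto
    then have "connected (KU x)" unfolding KU_def
      by (intro connected_Union) (auto intro: connected_upper_arc)
    moreover have "(\<Inter>(p, q)\<in>{(p, q)\<in>D. x = p \<or> x = q}. lower_arc (nat p) (nat q)) \<noteq> {}"
      using point' by (intro ex_in_conv[THEN iffD1] exI[of _ "of_nat (nat x)"]) auto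
    then have "connected (KD x)" unfolding KD_def
      by (intro connected_Union) (auto intro: connected_lower_arc)
    \<comment> \<open>\<open>KD x\<close> may be empty, because \<open>cover\<close> provides only
      upper arcs at each point.\<close>
    moreover have "KU x \<inter> KD x \<noteq> {}" if "KD x \<noteq> {}"
      using that inK[OF x] point' unfolding KD_def by blast
    ultimately show "connected (KU x \<union> KD x)"
      by (cases "KD x = {}") (auto intro: connected_Un)
    show "closed (KU x \<union> KD x)"
      unfolding KU_def KD_def
      by (intro closed_Un closed_UN)
        (auto intro: finite_subset[OF _ fin(1)] finite_subset[OF _ fin(2)] closed_upper_arc closed_lower_arc)
    show "KU x \<union> KD x \<noteq> {}" using inK[OF x] by blast
  next
    fix x y assume "(x, y) \<in> U \<union> D"
    then show "(KU x \<union> KD x) \<inter> (KU y \<union> KD y) \<noteq> {}"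
      using point[of x y x] point'[of x y x] unfolding KU_def KD_def by blast
  next
    fix x y assume "(KU x \<union> KD x) \<inter> (KU y \<union> KD y) \<noteq> {}"
    then obtain z where z: "z \<in> KU x \<union> KD x" "z \<in> KU y \<union> KD y" by blast
    \<comment> \<open>Stated for fresh \<open>x\<close> and \<open>y\<close>, so that it serves both
      orders. The chain passes through the common endpoint \<open>e\<close>.\<close>
    have mixed: "(x, y) \<in> equiv_hull (U \<union> D)" if "z \<in> KU x" "z \<in> KD y" for x y
    proof -
      from that obtain p q p' q' where pq: "(p, q) \<in> U" "x = p \<or> x = q" "z \<in> upper_arc (nat p) (nat q)"
        "(p', q') \<in> D" "y = p' \<or> y = q'" "z \<in> lower_arc (nat p') (nat q')"
        unfolding KU_def KD_def by blast
      from upper_arc_Int_lower_arc[OF pq(3,6)]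
      have "{nat p, nat q} \<inter> {nat p', nat q'} \<noteq> {}" by auto
      then have "{p, q} \<inter> {p', q'} \<noteq> {}" using U(1)[OF pq(1)] D(1)[OF pq(4)] by auto
      then obtain e where e: "e = p \<or> e = q" "e = p' \<or> e = q'" by blast
      have "(x, e) \<in> equiv_hull (U \<union> D)" using pq e by (intro equiv_hull_endpoints[of p q]) auto
      moreover have "(e, y) \<in> equiv_hull (U \<union> D)" using pq e by (intro equiv_hull_endpoints[of p' q']) auto
      ultimately show ?thesis by (rule rtrancl_trans)
    qed
    consider "z \<in> KU x" "z \<in> KU y" | "z \<in> KD x" "z \<in> KD y" | "z \<in> KU x" "z \<in> KD y" | "z \<in> KU y" "z \<in> KD x"
      using z by blast
    then show "(x, y) \<in> equiv_hull (U \<union> D)"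
    proof cases
      case 1
      then obtain p q p' q' where pq: "(p, q) \<in> U" "x = p \<or> x = q" "z \<in> upper_arc (nat p) (nat q)"
        "(p', q') \<in> U" "y = p' \<or> y = q'" "z \<in> upper_arc (nat p') (nat q')"
        unfolding KU_def by blast
      then have "(p', q') = (p, q)"
        using U by (intro noncrossing_upper_arc_eq[OF U(2)]) fastforce+
      with pq show ?thesis by (intro equiv_hull_endpoints[of p q]) auto
    next
      case 2
      then obtain p q p' q' where pq: "(p, q) \<in> D" "x = p \<or> x = q" "z \<in> lower_arc (nat p) (nat q)"
        "(p', q') \<in> D" "y = p' \<or> y = q'" "z \<in> lower_arc (nat p') (nat q')"
        unfolding KD_def by blast
      then have "(p', q') = (p, q)"
        using D by (intro noncrossing_lower_arc_eq[OF D(2)]) fastforce+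
      with pq show ?thesis by (intro equiv_hull_endpoints[of p q]) auto
    next
      case 3
      then show ?thesis by (rule mixed)
    next
      case 4
      then show ?thesis by (rule equiv_hull_sym[OF mixed])
    qed
  qed (use U(1) D(1) in \<open>fastforce+\<close>)
  ultimately show ?thesis by simp
qed

section \<open>The upper arcs of a tuple\<close>

text \<open>The offset \<open>s\<close> counts the points already passed; it allows splitting a
  tuple at its middle family and shifting the part to the right.\<close>

fun upper_pairs :: "int \<Rightarrow> nat list \<Rightarrow> (int \<times> int) set" where
  "upper_pairs s [] = {}"
| "upper_pairs s (a # as) = rainbow s (int a) \<union> upper_pairs (s + 2 * int a) as"

lemma upper_pairs_bounds:
  "(p, q) \<in> upper_pairs s as \<Longrightarrow> s < p \<and> p < q \<and> q \<le> s + 2 * int (sum_list as)"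
  by (induction as arbitrary: s) (fastforce simp: rainbow_def)+

lemma upper_pairs_cover:
  "s < x \<Longrightarrow> x \<le> s + 2 * int (sum_list as) \<Longrightarrow> \<exists>(p, q)\<in>upper_pairs s as. x = p \<or> x = q"
proof (induction as arbitrary: s)
  case (Cons a as)
  show ?case
  proof (cases "x \<le> s + 2 * int a")
    case True
    \<comment> \<open>The partner of \<open>x\<close> in its family; it differs from
      \<open>x\<close> by parity.\<close>
    let ?y = "2 * s + 2 * int a + 1 - x"
    have "x \<noteq> ?y" by presburger
    then have "(x, ?y) \<in> rainbow s a \<or> (?y, x) \<in> rainbow s a"
      using True Cons.prems by (auto simp: rainbow_def)
    then show ?thesis by fastforce
  next
    case False
    then show ?thesis using Cons.IH[of "s + 2 * int a"] Cons.prems by auto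
  qed
qed simp

lemma noncrossing_rainbow: "noncrossing (rainbow s a)"
  by (auto simp: noncrossing_def rainbow_def)

lemma noncrossing_upper_pairs: "noncrossing (upper_pairs s as)"
proof (induction as arbitrary: s)
  case (Cons a as)
  let ?V = "upper_pairs (s + 2 * int a) as"
  have *: "q < p'" if "(p, q) \<in> rainbow s a" "(p', q') \<in> ?V" for p q p' q'
    using that(1) upper_pairs_bounds[OF that(2)] by (auto simp: rainbow_def)
  show ?case
    unfolding noncrossing_def
  proof (intro allI impI, goal_cases)
    case (1 p q p' q')
    then consider "(p, q) \<in> rainbow s a" "(p', q') \<in> rainbow s a" | "(p, q) \<in> ?V" "(p', q') \<in> ?V"
      | "(p, q) \<in> rainbow s a" "(p', q') \<in> ?V" | "(p', q') \<in> rainbow s a" "(p, q) \<in> ?V" by auto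
    then show ?case
    proof cases
      case 1
      then show ?thesis using noncrossing_rainbow[of s a] unfolding noncrossing_def by blast
    next
      case 2
      then show ?thesis using Cons.IH[of "s + 2 * int a"] unfolding noncrossing_def by blast
    qed (use * in blast)+
  qed
qed (simp add: noncrossing_def)

lemma upper_pairs_append:
  "upper_pairs s (xs @ ys) = upper_pairs s xs \<union> upper_pairs (s + 2 * int (sum_list xs)) ys"
  by (induction xs arbitrary: s) (auto simp: algebra_simps)

lemma upper_pairs_shift: "(p, q) \<in> upper_pairs (s + t) as \<longleftrightarrow> (p - t, q - t) \<in> upper_pairs s as"
proof (induction as arbitrary: s)
  case (Cons a as)
  show ?case using Cons[of "s + 2 * int a"] by (auto simp: rainbow_def algebra_simps)
qed simp

lemma rainbow_nat: "rainbow (int s) (int a) = (\<lambda>i. (int (s + i), int (s + 2 * a + 1 - i))) ` {1..a}"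
proof (intro subset_antisym subsetI)
  fix e assume "e \<in> rainbow (int s) (int a)"
  then obtain p q where e: "e = (p, q)" "int s < p" "p < q" "p + q = 2 * int s + 2 * int a + 1"
    by (auto simp: rainbow_def)
  then show "e \<in> (\<lambda>i. (int (s + i), int (s + 2 * a + 1 - i))) ` {1..a}"
    by (intro image_eqI[of _ _ "nat (p - int s)"]) auto
qed (auto simp: rainbow_def)

lemma upper_pairs_nat:
  "upper_pairs (int s) as = (\<Union>m<length as. rainbow (int (s + 2 * sum_list (take m as))) (int (as ! m)))"
proof (induction as arbitrary: s)
  case (Cons a as)
  show ?case
    using Cons[of "s + 2 * a"] by (simp add: lessThan_Suc_eq_insert_0 image_image algebra_simps)
qed simp

lemma meander_eq:
  "meander as = (\<Union>(p, q)\<in>upper_pairs 0 as. upper_arc (nat p) (nat q)) \<union>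
     (\<Union>(p, q)\<in>rainbow 0 (int (sum_list as)). lower_arc (nat p) (nat q))"
proof -
  \<comment> \<open>\<open>F\<close> is kept general to cover upper and lower arcs alike.\<close>
  have *: "(\<Union>(p, q)\<in>rainbow (int s) (int a). F (nat p) (nat q)) = (\<Union>i\<in>{1..a}. F (s + i) (s + 2 * a + 1 - i))"
    for s a and F :: "nat \<Rightarrow> nat \<Rightarrow> complex set"
    by (simp only: rainbow_nat image_image prod.case nat_int)
  have "(\<Union>(p, q)\<in>upper_pairs 0 as. upper_arc (nat p) (nat q)) =
    (\<Union>m<length as. \<Union>(p, q)\<in>rainbow (int (2 * sum_list (take m as))) (int (as ! m)). upper_arc (nat p) (nat q))"
    using upper_pairs_nat[of 0 as] by (simp only: of_nat_0 add_0 UN_UN_flatten)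
  moreover have "(\<Union>(p, q)\<in>rainbow 0 (int (sum_list as)). lower_arc (nat p) (nat q)) =
    (\<Union>k\<in>{1..sum_list as}. lower_arc k (2 * sum_list as + 1 - k))"
    using *[of lower_arc 0] by (simp only: of_nat_0 add_0)
  ultimately show ?thesis
    by (simp only: meander_def Let_def *)
qed

text \<open>The passage from topology to combinatorics; all later statements about components go
  through orbits.\<close>

lemma num_components_orbits:
  "num_components as =
     orbits (upper_pairs 0 as \<union> rainbow 0 (int (sum_list as))) {1..2 * int (sum_list as)}"
  unfolding num_components_def meander_eq
proof (rule card_components_arcs)
  show "\<exists>(p, q)\<in>upper_pairs 0 as. x = p \<or> x = q" if "1 \<le> x" "x \<le> 2 * int (sum_list as)" for x
    using that by (intro upper_pairs_cover) auto
  show "1 \<le> p \<and> p < q \<and> q \<le> 2 * int (sum_list as)" if "(p, q) \<in> upper_pairs 0 as" for p q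
    using upper_pairs_bounds[OF that] by simp
  show "1 \<le> p \<and> p < q \<and> q \<le> 2 * int (sum_list as)" if "(p, q) \<in> rainbow 0 (int (sum_list as))" for p q
    using that by (simp add: rainbow_def)
qed (rule noncrossing_upper_pairs noncrossing_rainbow)+

section \<open>The recursion for the number of components\<close>

lemma num_components_append_Cons:
  "num_components (xs @ a # ys) =
     orbits (arcs (upper_pairs 0 xs) (int (sum_list xs)) (int a) (upper_pairs 0 ys) (int (sum_list ys)))
       {1..2 * (int (sum_list xs) + int a + int (sum_list ys))}"
proof -
  have "upper_pairs (2 * int (sum_list xs) + 2 * int a) ys =
     {(p, q). (p - 2 * int (sum_list xs) - 2 * int a, q - 2 * int (sum_list xs) - 2 * int a) \<in> upper_pairs 0 ys}"
    using upper_pairs_shift[of _ _ 0 "2 * int (sum_list xs) + 2 * int a" ys] by (auto simp: algebra_simps)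
  then show ?thesis
    by (simp add: num_components_orbits upper_pairs_append arcs_def Un_assoc add.assoc)
qed

text \<open>A family of size 0 has no arcs. This turns remainder 0 into deletion of the family, and
  likewise the size 0 left over in the balanced case.\<close>

lemma num_components_append_0: "num_components (xs @ 0 # ys) = num_components (xs @ ys)"
proof -
  have "rainbow s 0 = {}" for s by (auto simp: rainbow_def)
  then show ?thesis by (simp add: num_components_orbits upper_pairs_append)
qed

lemma upper_pairs_subset: "upper_pairs 0 as \<subseteq> {1..2 * int (sum_list as)} \<times> {1..2 * int (sum_list as)}"
  using upper_pairs_bounds[of _ _ 0 as] by fastforce

lemma num_components_mod:
  assumes "sum_list xs \<noteq> sum_list ys"
  shows "num_components (xs @ a # ys) =
    num_components (xs @ a mod nat \<bar>int (sum_list xs) - int (sum_list ys)\<bar> # ys)"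
  unfolding num_components_append_Cons zmod_int
  using orbits_arcs_mod[of "int (sum_list xs)" "int (sum_list ys)" "int a", OF _ _ _ _ upper_pairs_subset upper_pairs_subset]
    assms by simp

lemma num_components_balanced:
  assumes "sum_list xs = sum_list ys"
  shows "num_components (xs @ a # ys) = num_components (xs @ ys) + a"
  unfolding num_components_append_0[of xs ys, symmetric]
  unfolding num_components_append_Cons
  using orbits_arcs_balanced[of "int (sum_list ys)" "int a", OF _ _ _ upper_pairs_subset, of "upper_pairs 0 xs"]
    upper_pairs_subset[of xs] assms by simp

lemma num_components_Nil: "num_components [] = 0"
  by (simp add: num_components_def meander_def)

subsection \<open>Running the algorithm\<close>

lemma run_return [simp]: "run_state (State_Monad.return x) t = (x, t)"
  by (simp add: State_Monad.return_def)

lemma run_bind [simp]: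
  "run_state (State_Monad.bind x f) t = (let (y, t') = run_state x t in run_state (f y) t')"
  by (simp add: State_Monad.bind_def split: prod.split)

lemma run_ops [simp]:
  "run_state (add_op x y) t = (x + y, Suc t)" "run_state (sub_op x y) t = (x - y, Suc t)"
  "run_state (eq_op x y) t = (x = y, Suc t)" "run_state (less_op x y) t = (x < y, Suc t)"
  "run_state (rem_op x y) t = (x mod y, Suc t)"
  by (simp_all add: add_op_def sub_op_def eq_op_def less_op_def rem_op_def elementary_def)

lemma run_total: "run_state (total as) t = (sum_list as, t + length as)"
  by (induction as arbitrary: t) auto

text \<open>\<open>xs\<close> is the part already scanned; the assumption is the loop invariant and
  becomes the left inequality of \<open>is_middle\<close>. An entry costs at most two additions, a
  comparison and an index increment, hence the factor 4.\<close>

lemma run_find_middle: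
  assumes "2 * sum_list xs < sum_list (xs @ as)"
  shows "\<exists>m t'. run_state (find_middle (sum_list (xs @ as)) (length xs) (sum_list xs) as) t =
      ((m, arcs_left (xs @ as) m), t') \<and> is_middle (xs @ as) m \<and> t' \<le> t + 4 * length as"
  using assms
proof (induction as arbitrary: xs t)
  case (Cons a as)
  show ?case
  proof (cases "2 * sum_list (xs @ [a]) < sum_list (xs @ a # as)")
    case True
    then obtain m t' where "run_state (find_middle (sum_list (xs @ a # as)) (Suc (length xs)) (sum_list xs + a) as)
        (Suc (Suc (Suc (Suc t)))) = ((m, arcs_left (xs @ a # as) m), t')"
      "is_middle (xs @ a # as) m" "t' \<le> Suc (Suc (Suc (Suc t))) + 4 * length as"
      using Cons.IH[of "xs @ [a]" "Suc (Suc (Suc (Suc t)))"] by (auto simp: add.assoc)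
    then show ?thesis using True by auto
  next
    case False
    then have "is_middle (xs @ a # as) (length xs)" "arcs_left (xs @ a # as) (length xs) = sum_list xs"
      using Cons.prems by (auto simp: is_middle_def arcs_left_def)
    with False show ?thesis by auto
  qed
qed simp

text \<open>With sums \<open>L\<close>, \<open>R\<close> of \<open>xs\<close>, \<open>ys\<close>,
  the middle conditions read \<open>2 * L < L + a + R\<close> and
  \<open>L + a + R \<le> 2 * L + 2 * a\<close>, which bounds the difference of \<open>L\<close> and
  \<open>R\<close> by \<open>a\<close>.\<close>

lemma is_middle_split:
  assumes "is_middle as m" "\<forall>a\<in>set as. 0 < a"
  obtains xs a ys where "as = xs @ a # ys" "m = length xs" "middle as = length xs"
    "\<bar>int (sum_list xs) - int (sum_list ys)\<bar> \<le> int a"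
proof
  have m: "m < length as" and "as \<noteq> []" using assms by (auto simp: is_middle_def)
  show eq: "as = take m as @ as ! m # drop (Suc m) as" using m by (rule id_take_nth_drop)
  show "m = length (take m as)" using m by simp
  show "middle as = length (take m as)"
    using the1_equality[OF ex1_is_middle[OF \<open>as \<noteq> []\<close> assms(2)] assms(1)] m by (simp add: middle_def)
  have "sum_list as = sum_list (take m as) + as ! m + sum_list (drop (Suc m) as)"
    using arg_cong[OF eq, of sum_list] by simp
  moreover have "sum_list (take (Suc m) as) = sum_list (take m as) + as ! m"
    using m by (simp add: take_Suc_conv_app_nth)
  ultimately show "\<bar>int (sum_list (take m as)) - int (sum_list (drop (Suc m) as))\<bar> \<le> int (as ! m)"
    using assms(1) unfolding is_middle_def arcs_left_def by linarith
qed

text \<open>One step of the recursion without cost accounting: the new tuple and the number of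
  components split off. It links the program to the recursion for
  \<open>num_components\<close>.\<close>

definition reduct :: "nat list \<Rightarrow> nat list \<times> nat" where
  "reduct as = (let m = middle as; L = arcs_left as m; R = arcs_right as m; d = nat \<bar>int L - int R\<bar>
     in if L = R then (delete_nth m as, as ! m)
        else if d dvd as ! m then (delete_nth m as, 0)
        else (as[m := as ! m mod d], 0))"

lemma reduct_append_Cons:
  assumes "middle (xs @ a # ys) = length xs"
  defines "d \<equiv> nat \<bar>int (sum_list xs) - int (sum_list ys)\<bar>"
  shows "reduct (xs @ a # ys) =
    (if sum_list xs = sum_list ys then (xs @ ys, a)
     else if d dvd a then (xs @ ys, 0)
     else (xs @ a mod d # ys, 0))"
  using assms by (simp add: reduct_def arcs_left_def arcs_right_def delete_nth_def Let_def)

text \<open>With \<open>n\<close> entries, \<open>total\<close> costs \<open>n\<close>, the search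
  at most \<open>4 * n\<close>, and the rest at most 7 operations;
  \<open>5 * n + 7 \<le> 12 * n\<close> because \<open>n \<ge> 1\<close>.\<close>

lemma run_recursion_step:
  assumes "as \<noteq> []" "\<forall>a\<in>set as. 0 < a"
  shows "\<exists>t'. run_state (recursion_step as c) t = ((fst (reduct as), c + snd (reduct as)), t') \<and>
    t' \<le> t + 12 * length as"
proof -
  have "0 < sum_list as" using assms by (cases as) auto
  then obtain m t' where m: "run_state (find_middle (sum_list as) 0 0 as) (t + length as) =
      ((m, arcs_left as m), t')" "is_middle as m" "t' \<le> t + length as + 4 * length as"
    using run_find_middle[of "[]" as "t + length as"] by auto
  obtain xs a ys where as: "as = xs @ a # ys" and *: "m = length xs" "middle as = length xs"
    by (rule is_middle_split[OF m(2) assms(2)])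
  let ?d = "nat \<bar>int (sum_list xs) - int (sum_list ys)\<bar>"
  have eqs: "arcs_left as m = sum_list xs" "as ! m = a" "sum_list as - sum_list xs - a = sum_list ys"
    "delete_nth m as = xs @ ys" "as[m := r] = xs @ r # ys" for r
    unfolding as * by (auto simp: arcs_left_def delete_nth_def)
  have len: "length as \<ge> 1" using assms by (cases as) auto
  have "run_state (recursion_step as c) t =
    (if sum_list xs = sum_list ys then ((xs @ ys, c + a), Suc (Suc (Suc (Suc t'))))
     else if ?d dvd a then ((xs @ ys, c), Suc (Suc (Suc (Suc (Suc (Suc (Suc t')))))))
     else ((xs @ a mod ?d # ys, c), Suc (Suc (Suc (Suc (Suc (Suc (Suc t'))))))))"
  \<comment> \<open>The case decides which natural subtraction computes \<open>?d\<close> without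
    truncation.\<close>
  proof (cases "sum_list xs < sum_list ys")
    case True
    then have "?d = sum_list ys - sum_list xs" by simp
    then show ?thesis
      using True
      by (simp add: recursion_step_def run_total m(1) eqs mod_eq_0_iff_dvd del: diff_diff_left)
  next
    case False
    then have "?d = sum_list xs - sum_list ys" by simp
    then show ?thesis
      using False
      by (simp add: recursion_step_def run_total m(1) eqs mod_eq_0_iff_dvd del: diff_diff_left)
  qed
  then show ?thesis
    using m(3) len reduct_append_Cons[OF *(2)[unfolded as], folded as]
    by simp
qed

section \<open>Loss of input bits and termination\<close>

abbreviation bits :: "nat \<Rightarrow> nat" where
  "bits a \<equiv> nat \<lceil>log 2 (real a + 1)\<rceil>"

lemma bits_pos: "0 < a \<Longrightarrow> 0 < bits a"
  by simp

text \<open>The quotient is at least 1, so \<open>a\<close> is at least \<open>d\<close> plus the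
  remainder \<open>r\<close>, and \<open>r < d\<close>. Hence \<open>2 * r + 1 \<le> a\<close>, so
  \<open>r + 1\<close> is at most half of \<open>a + 1\<close> and the logarithm drops by at least
  1.\<close>

lemma bits_mod_less:
  assumes "0 < d" "d \<le> a"
  shows "bits (a mod d) < bits a"
proof -
  let ?r = "a mod d"
  have "d * 1 \<le> d * (a div d)" using assms by (intro mult_le_mono2) (simp add: div_greater_zero_iff Suc_leI)
  with mult_div_mod_eq[of d a] have "d + ?r \<le> a" by linarith
  moreover have "?r < d" using assms by simp
  ultimately have "2 * ?r + 1 \<le> a" by linarith
  then have "real (2 * ?r + 1) \<le> real a" by (rule of_nat_mono)
  then have "real ?r + 1 \<le> (real a + 1) / 2" by simp
  then have "log 2 (real ?r + 1) \<le> log 2 ((real a + 1) / 2)" by simp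
  also have "\<dots> = log 2 (real a + 1) - 1" by (simp add: log_divide)
  finally have "\<lceil>log 2 (real ?r + 1)\<rceil> \<le> \<lceil>log 2 (real a + 1)\<rceil> - 1"
    by (metis ceiling_diff_one ceiling_mono)
  moreover have "0 < \<lceil>log 2 (real a + 1)\<rceil>" using assms by simp
  ultimately show ?thesis by linarith
qed

text \<open>Deletion loses the positive number \<open>bits a\<close>; a remainder loses a bit
  because the divisor is at most \<open>a\<close> for the middle family. Entries stay positive, as a
  remainder is kept only if nonzero.\<close>

lemma reduct_decreases:
  assumes "as \<noteq> []" "\<forall>a\<in>set as. 0 < a"
  shows "\<forall>a\<in>set (fst (reduct as)). 0 < a" "length (fst (reduct as)) \<le> length as"
    "input_bits (fst (reduct as)) < input_bits as"
proof -
  obtain m where "is_middle as m" using ex1_is_middle[OF assms] by blast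
  from is_middle_split[OF this assms(2)] obtain xs a ys
    where as: "as = xs @ a # ys" and mid: "middle as = length xs"
      and d: "\<bar>int (sum_list xs) - int (sum_list ys)\<bar> \<le> int a" by metis
  note red = reduct_append_Cons[OF mid[unfolded as]]
  show "\<forall>a\<in>set (fst (reduct as)). 0 < a" "length (fst (reduct as)) \<le> length as"
    using assms unfolding as red by (auto simp: dvd_eq_mod_eq_0)
  have "0 < bits a" using assms as by (intro bits_pos) simp
  then show "input_bits (fst (reduct as)) < input_bits as"
    using bits_mod_less[of "nat \<bar>int (sum_list xs) - int (sum_list ys)\<bar>" a] d
    unfolding as red by (simp add: input_bits_def)
qed

text \<open>Any \<open>Z\<close> obeying the recursion is what the loop computes. Each iteration
  loses an input bit and the tuple never grows, so the cost is at most \<open>12 * length as\<close>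
  per bit.\<close>

lemma while_option_recursion_step:
  assumes Z: "\<And>as. as \<noteq> [] \<Longrightarrow> \<forall>a\<in>set as. 0 < a \<Longrightarrow> Z as = Z (fst (reduct as)) + snd (reduct as)"
    and "Z [] = 0" "\<forall>a\<in>set as. 0 < a"
  shows "\<exists>t'. while_option (\<lambda>((bs, _), _). bs \<noteq> []) (\<lambda>((bs, c), t). run_state (recursion_step bs c) t)
      ((as, c), t) = Some (([], c + Z as), t') \<and> t' \<le> t + 12 * length as * input_bits as"
  using assms(3)
proof (induction "input_bits as" arbitrary: as c t rule: less_induct)
  case less
  show ?case
  proof (cases "as = []")
    case True
    then show ?thesis using assms(2) by (subst while_option_unfold) simp
  next
    case False
    let ?as = "fst (reduct as)"
    note dec = reduct_decreases[OF False less.prems]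
    obtain t1 where t1: "run_state (recursion_step as c) t = ((?as, c + snd (reduct as)), t1)"
      "t1 \<le> t + 12 * length as"
      using run_recursion_step[OF False less.prems] by blast
    obtain t2 where t2: "while_option (\<lambda>((bs, _), _). bs \<noteq> []) (\<lambda>((bs, c), t). run_state (recursion_step bs c) t)
      ((?as, c + snd (reduct as)), t1) = Some (([], c + snd (reduct as) + Z ?as), t2)"
      "t2 \<le> t1 + 12 * length ?as * input_bits ?as"
      using less.hyps[OF dec(3,1)] by blast
    have "t2 \<le> t + 12 * length as * (1 + input_bits ?as)"
    proof -
      have "length ?as * input_bits ?as \<le> length as * input_bits ?as" using dec(2) by (rule mult_le_mono1)
      with t1(2) t2(2) show ?thesis unfolding distrib_left mult.assoc by linarith
    qed
    also have "\<dots> \<le> t + 12 * length as * input_bits as"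
      using dec(3) by (intro add_left_mono mult_le_mono2) simp
    finally show ?thesis
      using t1(1) t2(1) False Z[OF False less.prems] by (subst while_option_unfold) (simp add: ac_simps)
  qed
qed

text \<open>Divisibility is the case of remainder 0, where the emptied family is dropped.\<close>

lemma num_components_reduct:
  assumes "as \<noteq> []" "\<forall>a\<in>set as. 0 < a"
  shows "num_components as = num_components (fst (reduct as)) + snd (reduct as)"
proof -
  obtain m where "is_middle as m" using ex1_is_middle[OF assms] by blast
  from is_middle_split[OF this assms(2)] obtain xs a ys
    where as: "as = xs @ a # ys" and mid: "middle as = length xs" by metis
  let ?d = "nat \<bar>int (sum_list xs) - int (sum_list ys)\<bar>"
  have "num_components (xs @ a # ys) = num_components (xs @ ys)"
    if "sum_list xs \<noteq> sum_list ys" "?d dvd a"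
    using num_components_mod[OF that(1), of a] that(2) num_components_append_0[of xs ys]
    by (simp only: dvd_imp_mod_0)
  then show ?thesis
    using num_components_balanced[of xs ys a] num_components_mod[of xs ys a]
    unfolding as reduct_append_Cons[OF mid[unfolded as]] by (simp split: if_split)
qed

theorem theorem6p3:
  shows "(\<forall>as :: nat list. as \<noteq> [] \<and> (\<forall>a\<in>set as. 0 < a) \<longrightarrow>
            num_components as =
              (let m = middle as; L = arcs_left as m; R = arcs_right as m;
                   d = nat \<bar>int L - int R\<bar>
               in if L = R then num_components (delete_nth m as) + as ! m
                  else if d dvd as ! m then num_components (delete_nth m as)
                  else num_components (as[m := (as ! m) mod d]))) \<and>
         (\<exists>C :: nat. \<forall>as :: nat list. as \<noteq> [] \<and> (\<forall>a\<in>set as. 0 < a) \<longrightarrow>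
            (\<exists>t. count_components as = Some (num_components as, t) \<and>
                 t \<le> C * input_bits as * length as))"
\<comment> \<open>The constant 12 is the cost per entry and iteration. Both conjuncts quantify over
  the same tuples and share one block.\<close>
proof (rule conjI; (rule exI[of _ 12])?; intro allI impI)
  fix as :: "nat list"
  assume as: "as \<noteq> [] \<and> (\<forall>a\<in>set as. 0 < a)"
  then show "num_components as =
      (let m = middle as; L = arcs_left as m; R = arcs_right as m;
           d = nat \<bar>int L - int R\<bar>
       in if L = R then num_components (delete_nth m as) + as ! m
          else if d dvd as ! m then num_components (delete_nth m as)
          else num_components (as[m := (as ! m) mod d]))"
    using num_components_reduct[of as] unfolding reduct_def Let_def by (simp split: if_splits)
  obtain t where "while_option (\<lambda>((bs, _), _). bs \<noteq> []) (\<lambda>((bs, c), t). run_state (recursion_step bs c) t)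
      ((as, 0), 0) = Some (([], 0 + num_components as), t)" "t \<le> 0 + 12 * length as * input_bits as"
    using while_option_recursion_step[of num_components as 0 0, OF num_components_reduct num_components_Nil]
      as by blast
  then show "\<exists>t. count_components as = Some (num_components as, t) \<and> t \<le> 12 * input_bits as * length as"
    by (simp add: count_components_def ac_simps)
qed

end
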